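(* Let $\mathbb{F}=\mathbb{R}$ or $\mathbb{C}$, let $K$ be a simplicial complex with finitely many simplices in each dimension, let $w:K\to\mathbb{R}^+$ be a function, and equip each $C^i(K;\mathbb{F})$ with the weighted inner product $(f,g)_{C^i}=\sum_\sigma w(\sigma)f(\sigma)\overline{g(\sigma)}$ ($\sigma$ running over the $i$-simplices of $K$), represented by the diagonal matrix $W_i$. Let $\phi:K\times K\to\mathbb{F}$ be the identity weight function, i.e. $\phi(\sigma,d_i\sigma)\equiv 1$ for all $\sigma\in K$ and all $i$, and let $\delta$ denote the $\phi$-weighted coboundary operator. Then $$[\Delta_i^{up}]=[\mathcal{L}_i^{up}]=W_i^{-1}D_i^TW_{i+1}D_i,$$ $$[\Delta_i^{down}]=[\mathcal{L}_i^{down}]=D_{i-1}W_{i-1}^{-1}D_{i-1}^TW_i,$$ where $D_i$ is the matrix corresponding to the usual unweighted coboundary operator $\widetilde{\delta_i}$.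
   Context: Fix a total order on the vertices of $K$; simplices are written $\sigma=[v_{a_0},\dots,v_{a_n}]$ with $a_0<\dots<a_n$, and $d_i\sigma$ is the face obtained by deleting the $i$-th vertex. $C_n(K;\mathbb{F})$ is the $\mathbb{F}$-vector space with basis the $n$-simplices, and $C^n(K;\mathbb{F})=\operatorname{Hom}_{\mathbb{F}}(C_n(K;\mathbb{F}),\mathbb{F})$, with basis the dual basis of elementary cochains $\sigma^*$ (and $C^{-1}=0$). For a weight function $\phi$, the $\phi$-weighted boundary map is $\partial_n(\sigma)=\sum_i(-1)^i\phi(\sigma,d_i\sigma)d_i\sigma$ (with $\partial_0=0$), and the $\phi$-weighted coboundary operator $\delta_n:C^n(K;\mathbb{F})\to C^{n+1}(K;\mathbb{F})$ is $\delta_n f=f\circ\partial_{n+1}$. $\widetilde{\delta_n}$ is the usual simplicial coboundary operator $(\widetilde{\delta_n}f)(\sigma)=\sum_i(-1)^if(d_i\sigma)$. Adjoints $\delta_n^*$, $\widetilde{\delta_n}^*$ are taken with respect to the given weighted inner products. $\Delta_i^{up}=\delta_i^*\delta_i$, $\Delta_i^{down}=\delta_{i-1}\delta_{i-1}^*$, $\mathcal{L}_i^{up}=\widetilde{\delta_i}^*\widetilde{\delta_i}$, $\mathcal{L}_i^{down}=\widetilde{\delta_{i-1}}\widetilde{\delta_{i-1}}^*$. Brackets $[\cdot]$ denote matrices with respect to the bases of elementary cochains. $W_i=\operatorname{diag}(w(\sigma_1),\dots,w(\sigma_m))$, where $\sigma_1,\dots,\sigma_m$ are the $i$-simplices of $K$.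 *)

theory Defs
  imports "Jordan_Normal_Form.Gauss_Jordan_Elimination" "Jordan_Normal_Form.Conjugate"
begin

text \<open>
  Abstract simplicial complexes are sets of finite nonempty vertex sets; the total order on the
  vertices is the one of the type class \<open>linorder\<close>.  Dimensions are integers, so that
  degree \<open>-1\<close> needs no separate treatment: there are no \<open>(-1)\<close>-simplices, since the
  empty set is not a simplex.
\<close>

definition simplicial_complex :: "'v set set \<Rightarrow> bool" where
  "simplicial_complex K \<longleftrightarrow>
     (\<forall>\<sigma>\<in>K. finite \<sigma> \<and> \<sigma> \<noteq> {}) \<and> (\<forall>\<sigma>\<in>K. \<forall>\<tau>. \<tau> \<subseteq> \<sigma> \<and> \<tau> \<noteq> {} \<longrightarrow> \<tau> \<in> K)"

definition simplices :: "'v set set \<Rightarrow> int \<Rightarrow> 'v set set" where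
  "simplices K n = {\<sigma> \<in> K. int (card \<sigma>) = n + 1}"

definition face :: "nat \<Rightarrow> 'v::linorder set \<Rightarrow> 'v set" where
  "face i \<sigma> = \<sigma> - {sorted_list_of_set \<sigma> ! i}"

type_synonym ('v, 'f) chain = "'v set \<Rightarrow> 'f"
type_synonym ('v, 'f) cochain = "('v, 'f) chain \<Rightarrow> 'f"

text \<open>The free vector space on the \<open>n\<close>-simplices, as finitely supported coefficient functions.\<close>

definition chain_space :: "'v set set \<Rightarrow> int \<Rightarrow> ('v, 'f::field) chain set" where
  "chain_space K n = {c. finite {\<sigma>. c \<sigma> \<noteq> 0} \<and> {\<sigma>. c \<sigma> \<noteq> 0} \<subseteq> simplices K n}"

definition basis_chain :: "'v set \<Rightarrow> ('v, 'f::field) chain" where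
  "basis_chain \<sigma> = (\<lambda>\<tau>. if \<tau> = \<sigma> then 1 else 0)"

text \<open>
  The dual space of \<open>chain_space K n\<close>.  Functionals are extended by \<open>0\<close> to functions that are
  not \<open>n\<close>-chains, so that the vector space operations and equality are the pointwise ones.
  The value of a cochain \<open>f\<close> on a simplex \<open>\<sigma>\<close> is \<open>f (basis_chain \<sigma>)\<close>.
\<close>

definition cochain_space :: "'v set set \<Rightarrow> int \<Rightarrow> ('v, 'f::field) cochain set" where
  "cochain_space K n = {f.
     (\<forall>c\<in>chain_space K n. \<forall>d\<in>chain_space K n. f (\<lambda>\<sigma>. c \<sigma> + d \<sigma>) = f c + f d) \<and>
     (\<forall>a. \<forall>c\<in>chain_space K n. f (\<lambda>\<sigma>. a * c \<sigma>) = a * f c) \<and>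
     (\<forall>c. c \<notin> chain_space K n \<longrightarrow> f c = 0)}"

definition elementary_cochain :: "'v set set \<Rightarrow> int \<Rightarrow> 'v set \<Rightarrow> ('v, 'f::field) cochain" where
  "elementary_cochain K n \<sigma> = (\<lambda>c. if c \<in> chain_space K n then c \<sigma> else 0)"

definition boundary ::
  "('v::linorder set \<Rightarrow> 'v set \<Rightarrow> 'f::field) \<Rightarrow> int \<Rightarrow> ('v, 'f) chain \<Rightarrow> ('v, 'f) chain" where
  "boundary \<phi> n c =
     (if n \<le> 0 then (\<lambda>\<tau>. 0)
      else (\<lambda>\<tau>. \<Sum>\<sigma> | c \<sigma> \<noteq> 0. c \<sigma> *
             (\<Sum>i\<le>nat n. (-1) ^ i * \<phi> \<sigma> (face i \<sigma>) * basis_chain (face i \<sigma>) \<tau>)))"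

definition weighted_coboundary ::
  "'v::linorder set set \<Rightarrow> ('v set \<Rightarrow> 'v set \<Rightarrow> 'f::field) \<Rightarrow> int
     \<Rightarrow> ('v, 'f) cochain \<Rightarrow> ('v, 'f) cochain" where
  "weighted_coboundary K \<phi> n f =
     (\<lambda>c. if c \<in> chain_space K (n + 1) then f (boundary \<phi> (n + 1) c) else 0)"

text \<open>
  The usual coboundary is given by its values \<open>\<Sum>i. (-1)^i * f (face i \<sigma>)\<close> on simplices and is
  extended linearly.  In degree \<open>-1\<close> it vanishes, as \<open>cochain_space K (-1)\<close> is the zero space.
\<close>

definition coboundary ::
  "'v::linorder set set \<Rightarrow> int \<Rightarrow> ('v, 'f::field) cochain \<Rightarrow> ('v, 'f) cochain" where
  "coboundary K n f =
     (\<lambda>c. if c \<in> chain_space K (n + 1)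
          then \<Sum>\<sigma> | c \<sigma> \<noteq> 0. c \<sigma> * (\<Sum>i\<le>nat (n + 1). (-1) ^ i * f (basis_chain (face i \<sigma>)))
          else 0)"

text \<open>Vertices are excluded: the face of a \<open>0\<close>-simplex is empty and hence not in \<open>K\<close>.\<close>

definition identity_weight ::
  "'v::linorder set set \<Rightarrow> ('v set \<Rightarrow> 'v set \<Rightarrow> 'f::field) \<Rightarrow> bool" where
  "identity_weight K \<phi> \<longleftrightarrow> (\<forall>\<sigma>\<in>K. card \<sigma> \<ge> 2 \<longrightarrow> (\<forall>i<card \<sigma>. \<phi> \<sigma> (face i \<sigma>) = 1))"

text \<open>
  The sort \<open>{real_field, conjugatable_field}\<close> is meant to be used at \<open>real\<close> and \<open>complex\<close>,
  where \<open>conjugate\<close> is the identity and \<open>cnj\<close>, respectively.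
\<close>

definition cochain_inner ::
  "'v set set \<Rightarrow> ('v set \<Rightarrow> real) \<Rightarrow> int \<Rightarrow> ('v, 'f::{real_field, conjugatable_field}) cochain
     \<Rightarrow> ('v, 'f) cochain \<Rightarrow> 'f" where
  "cochain_inner K w n f g =
     (\<Sum>\<sigma>\<in>simplices K n. of_real (w \<sigma>) * f (basis_chain \<sigma>) * conjugate (g (basis_chain \<sigma>)))"

text \<open>
  The adjoint of \<open>T : cochain_space K m \<rightarrow> cochain_space K n\<close>.  For positive \<open>w\<close> its values on
  \<open>cochain_space K n\<close> are uniquely determined; elsewhere they are irrelevant.
\<close>

definition cochain_adjoint ::
  "'v set set \<Rightarrow> ('v set \<Rightarrow> real) \<Rightarrow> int \<Rightarrow> int
     \<Rightarrow> (('v, 'f::{real_field, conjugatable_field}) cochain \<Rightarrow> ('v, 'f) cochain)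
     \<Rightarrow> ('v, 'f) cochain \<Rightarrow> ('v, 'f) cochain" where
  "cochain_adjoint K w m n T =
     (SOME S. (\<forall>g\<in>cochain_space K n. S g \<in> cochain_space K m) \<and>
        (\<forall>f\<in>cochain_space K m. \<forall>g\<in>cochain_space K n.
           cochain_inner K w n (T f) g = cochain_inner K w m f (S g)))"

definition weighted_up_laplacian ::
  "'v::linorder set set \<Rightarrow> ('v set \<Rightarrow> real)
     \<Rightarrow> ('v set \<Rightarrow> 'v set \<Rightarrow> 'f::{real_field, conjugatable_field}) \<Rightarrow> int
     \<Rightarrow> ('v, 'f) cochain \<Rightarrow> ('v, 'f) cochain" where
  "weighted_up_laplacian K w \<phi> i =
     cochain_adjoint K w i (i + 1) (weighted_coboundary K \<phi> i) \<circ> weighted_coboundary K \<phi> i"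

definition weighted_down_laplacian ::
  "'v::linorder set set \<Rightarrow> ('v set \<Rightarrow> real)
     \<Rightarrow> ('v set \<Rightarrow> 'v set \<Rightarrow> 'f::{real_field, conjugatable_field}) \<Rightarrow> int
     \<Rightarrow> ('v, 'f) cochain \<Rightarrow> ('v, 'f) cochain" where
  "weighted_down_laplacian K w \<phi> i =
     weighted_coboundary K \<phi> (i - 1) \<circ> cochain_adjoint K w (i - 1) i (weighted_coboundary K \<phi> (i - 1))"

definition up_laplacian ::
  "'v::linorder set set \<Rightarrow> ('v set \<Rightarrow> real) \<Rightarrow> int
     \<Rightarrow> ('v, 'f::{real_field, conjugatable_field}) cochain \<Rightarrow> ('v, 'f) cochain" where
  "up_laplacian K w i = cochain_adjoint K w i (i + 1) (coboundary K i) \<circ> coboundary K i"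

definition down_laplacian ::
  "'v::linorder set set \<Rightarrow> ('v set \<Rightarrow> real) \<Rightarrow> int
     \<Rightarrow> ('v, 'f::{real_field, conjugatable_field}) cochain \<Rightarrow> ('v, 'f) cochain" where
  "down_laplacian K w i = coboundary K (i - 1) \<circ> cochain_adjoint K w (i - 1) i (coboundary K (i - 1))"

text \<open>
  A family \<open>s\<close> of lists enumerates the simplices in each dimension, which orders the bases of
  elementary cochains.  The coefficient of \<open>\<sigma>\<^sup>*\<close> in a cochain is its value on \<open>\<sigma>\<close>
  (lemma \<open>cochain_expansion\<close> below); \<open>cochain_matrix K s m n T\<close> is the matrix of
  \<open>T : cochain_space K m \<rightarrow> cochain_space K n\<close>, characterized by lemma \<open>cochain_matrix_column\<close>.
\<close>

definition enumerates_simplices :: "'v set set \<Rightarrow> (int \<Rightarrow> 'v set list) \<Rightarrow> bool" where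
  "enumerates_simplices K s \<longleftrightarrow> (\<forall>n. distinct (s n) \<and> set (s n) = simplices K n)"

definition cochain_matrix ::
  "'v set set \<Rightarrow> (int \<Rightarrow> 'v set list) \<Rightarrow> int \<Rightarrow> int
     \<Rightarrow> (('v, 'f::field) cochain \<Rightarrow> ('v, 'f) cochain) \<Rightarrow> 'f mat" where
  "cochain_matrix K s m n T =
     mat (length (s n)) (length (s m))
       (\<lambda>(r, c). T (elementary_cochain K m (s m ! c)) (basis_chain (s n ! r)))"

definition weight_matrix ::
  "('v set \<Rightarrow> real) \<Rightarrow> (int \<Rightarrow> 'v set list) \<Rightarrow> int \<Rightarrow> 'f::real_field mat" where
  "weight_matrix w s n =
     mat (length (s n)) (length (s n)) (\<lambda>(r, c). if r = c then of_real (w (s n ! r)) else 0)"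

abbreviation inverse_mat :: "'f::field mat \<Rightarrow> 'f mat" where
  "inverse_mat A \<equiv> the (mat_inverse A)"

lemma basis_chain_in_chain_space: "\<sigma> \<in> simplices K n \<Longrightarrow> basis_chain \<sigma> \<in> chain_space K n"
  by (auto simp: chain_space_def basis_chain_def)

lemma elementary_cochain_basis_chain:
  fixes \<sigma> :: "'v set"
  assumes "\<tau> \<in> simplices K n"
  shows "elementary_cochain K n \<sigma> (basis_chain \<tau>) = (if \<sigma> = \<tau> then 1 else (0::'f::field))"
  using basis_chain_in_chain_space[OF assms, where 'b = 'f]
  by (simp add: elementary_cochain_def) (simp add: basis_chain_def)

lemma elementary_cochain_in_cochain_space: "elementary_cochain K n \<sigma> \<in> cochain_space K n"
proof -
  have add: "(\<lambda>\<sigma>. c \<sigma> + d \<sigma>) \<in> chain_space K n"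
    if "c \<in> chain_space K n" "d \<in> chain_space K n" for c d :: "('a, 'b) chain"
  proof -
    have sub: "{\<sigma>. c \<sigma> + d \<sigma> \<noteq> 0} \<subseteq> {\<sigma>. c \<sigma> \<noteq> 0} \<union> {\<sigma>. d \<sigma> \<noteq> 0}" by auto
    then have "finite {\<sigma>. c \<sigma> + d \<sigma> \<noteq> 0}"
      using that finite_subset[OF sub] by (simp add: chain_space_def)
    with sub that show ?thesis unfolding chain_space_def by blast
  qed
  have scale: "(\<lambda>\<sigma>. a * c \<sigma>) \<in> chain_space K n" if "c \<in> chain_space K n" for a and c :: "('a, 'b) chain"
    using that by (auto simp: chain_space_def)
  show ?thesis
    by (auto simp: cochain_space_def elementary_cochain_def add scale)
qed

lemma cochain_expansion:
  fixes f :: "('v, 'f::field) cochain"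
  assumes "enumerates_simplices K s" and f: "f \<in> cochain_space K n"
  shows "f = (\<lambda>c. \<Sum>r<length (s n). f (basis_chain (s n ! r)) * elementary_cochain K n (s n ! r) c)"
proof
  fix c :: "('v, 'f) chain"
  have dist: "distinct (s n)" and set: "set (s n) = simplices K n"
    using assms(1) by (auto simp: enumerates_simplices_def)
  show "f c = (\<Sum>r<length (s n). f (basis_chain (s n ! r)) * elementary_cochain K n (s n ! r) c)"
  proof (cases "c \<in> chain_space K n")
    case False
    with f show ?thesis by (simp add: cochain_space_def elementary_cochain_def)
  next
    case True
    have add: "f (\<lambda>\<sigma>. c \<sigma> + d \<sigma>) = f c + f d" if "c \<in> chain_space K n" "d \<in> chain_space K n" for c d
      using f that by (simp add: cochain_space_def)
    have scale: "f (\<lambda>\<sigma>. a * c \<sigma>) = a * f c" if "c \<in> chain_space K n" for a c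
      using f that by (simp add: cochain_space_def)
    have f0: "f (\<lambda>\<sigma>. 0) = 0"
      using scale[of "\<lambda>\<sigma>. 0" 0] by (simp add: chain_space_def)
    have part: "f (\<lambda>\<tau>. if \<tau> \<in> A then c \<tau> else 0) = (\<Sum>\<sigma>\<in>A. c \<sigma> * f (basis_chain \<sigma>))"
      if "finite A" "A \<subseteq> simplices K n" for A
      using that
    proof (induction A rule: finite_induct)
      case empty
      then show ?case by (simp add: f0)
    next
      case (insert x A)
      have 1: "(\<lambda>\<tau>. if \<tau> \<in> insert x A then c \<tau> else 0) =
          (\<lambda>\<tau>. c x * basis_chain x \<tau> + (if \<tau> \<in> A then c \<tau> else 0))"
        using insert by (auto simp: basis_chain_def fun_eq_iff)
      have 2: "(\<lambda>\<tau>. c x * basis_chain x \<tau>) \<in> chain_space K n"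
        using insert by (auto simp: chain_space_def basis_chain_def)
      have 3: "(\<lambda>\<tau>. if \<tau> \<in> A then c \<tau> else 0) \<in> chain_space K n"
        using insert by (auto simp: chain_space_def split: if_splits
            intro: finite_subset[OF _ insert.hyps(1)])
      show ?case
        unfolding 1 using add[OF 2 3] scale[OF basis_chain_in_chain_space] insert by simp
    qed
    have "(\<lambda>\<tau>. if \<tau> \<in> simplices K n then c \<tau> else 0) = c"
      using True by (auto simp: chain_space_def fun_eq_iff)
    moreover have "finite (simplices K n)"
      using set by (metis List.finite_set)
    ultimately have "f c = (\<Sum>\<sigma>\<in>simplices K n. c \<sigma> * f (basis_chain \<sigma>))"
      using part[of "simplices K n"] by simp
    also have "\<dots> = (\<Sum>r<length (s n). c (s n ! r) * f (basis_chain (s n ! r)))"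
      using sum.reindex_bij_betw[OF bij_betw_nth[OF dist refl set[symmetric]], symmetric] by fast
    finally show ?thesis
      using True by (simp add: elementary_cochain_def mult.commute)
  qed
qed

lemma cochain_matrix_column:
  assumes "enumerates_simplices K s" and "\<And>f. f \<in> cochain_space K m \<Longrightarrow> T f \<in> cochain_space K n"
    and "j < length (s m)"
  shows "T (elementary_cochain K m (s m ! j)) =
    (\<lambda>c. \<Sum>r<length (s n). cochain_matrix K s m n T $$ (r, j) * elementary_cochain K n (s n ! r) c)"
  by (subst cochain_expansion[OF assms(1) assms(2)[OF elementary_cochain_in_cochain_space]])
    (use assms(3) in \<open>simp add: cochain_matrix_def\<close>)

end

theory Submission
  imports Defs
begin

text \<open>
  A cochain is the linear combination of elementary cochains whose coefficients are its values on
  simplices, so a linear map between cochain spaces is determined by its matrix, and composition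
  becomes the matrix product (\<open>cochain_matrix_comp\<close>).  Everything then rests on two facts.

  First, when every \<open>\<phi> \<sigma> (face i \<sigma>)\<close> is \<open>1\<close>, evaluating a cochain on the weighted boundary of a chain
  gives, by linearity, exactly the alternating sum that defines the usual coboundary
  (\<open>weighted_coboundary_identity_weight\<close>).  The adjoint depends on an operator only through its
  values on cochains, so the weighted and the usual Laplacians have the same matrices.

  Second, testing \<open>(T f, g) = (f, T\<^sup>* g)\<close> against \<open>f = \<sigma>\<^sup>*\<close> leaves a single term on the right, namely
  \<open>w \<sigma>\<close> times the conjugate of \<open>(T\<^sup>* g) \<sigma>\<close>.  Solving for that value divides by \<open>w \<sigma>\<close>, and reading
  off the entries gives \<open>W\<^sub>m\<^sup>-\<^sup>1 D\<^sup>H W\<^sub>n\<close> as the matrix of the adjoint of an operator \<open>T\<close> with matrix \<open>D\<close>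
  (\<open>cochain_matrix_adjoint\<close>), where \<open>D\<^sup>H\<close> is the conjugate transpose.  The coboundary has real
  entries, so there \<open>D\<^sup>H\<close> is the plain transpose.  Multiplying the matrices of the adjoint and the
  coboundary in the two possible orders gives the two formulas.

  Real and complex coefficients are treated at once: the only property of the conjugation that
  the computation needs beyond the algebraic laws is that it fixes the real numbers.
\<close>

section \<open>Linear algebra of chains and cochains\<close>

lemma chain_space_zero: "(\<lambda>\<sigma>. 0) \<in> chain_space K n"
  by (simp add: chain_space_def)

lemma chain_space_add:
  assumes "c \<in> chain_space K n" "d \<in> chain_space K n"
  shows "(\<lambda>\<sigma>. c \<sigma> + d \<sigma>) \<in> chain_space K n"
proof -
  have sub: "{\<sigma>. c \<sigma> + d \<sigma> \<noteq> 0} \<subseteq> {\<sigma>. c \<sigma> \<noteq> 0} \<union> {\<sigma>. d \<sigma> \<noteq> 0}" by auto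
  then have "finite {\<sigma>. c \<sigma> + d \<sigma> \<noteq> 0}"
    using assms finite_subset[OF sub] by (simp add: chain_space_def)
  with sub assms show ?thesis unfolding chain_space_def by blast
qed

lemma chain_space_scale: "c \<in> chain_space K n \<Longrightarrow> (\<lambda>\<sigma>. a * c \<sigma>) \<in> chain_space K n"
  by (auto simp: chain_space_def)

lemma chain_space_sum:
  assumes "finite A" "\<And>x. x \<in> A \<Longrightarrow> b x \<in> chain_space K n"
  shows "(\<lambda>\<tau>. \<Sum>x\<in>A. a x * b x \<tau>) \<in> chain_space K n"
  using assms
  by (induction A rule: finite_induct) (simp_all add: chain_space_zero chain_space_add chain_space_scale)

lemma cochain_eval_add:
  assumes "f \<in> cochain_space K n" "c \<in> chain_space K n" "d \<in> chain_space K n"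
  shows "f (\<lambda>\<sigma>. c \<sigma> + d \<sigma>) = f c + f d"
  using assms by (simp add: cochain_space_def)

lemma cochain_eval_scale:
  assumes "f \<in> cochain_space K n" "c \<in> chain_space K n"
  shows "f (\<lambda>\<sigma>. a * c \<sigma>) = a * f c"
  using assms by (simp add: cochain_space_def)

lemma cochain_eval_zero:
  assumes "f \<in> cochain_space K n"
  shows "f (\<lambda>\<sigma>. 0) = 0"
  using cochain_eval_scale[OF assms chain_space_zero, of 0] by simp

lemma cochain_eval_outside: "f \<in> cochain_space K n \<Longrightarrow> c \<notin> chain_space K n \<Longrightarrow> f c = 0"
  by (simp add: cochain_space_def)

lemma cochain_eval_sum:
  assumes f: "f \<in> cochain_space K n" and "finite A" "\<And>x. x \<in> A \<Longrightarrow> b x \<in> chain_space K n"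
  shows "f (\<lambda>\<tau>. \<Sum>x\<in>A. a x * b x \<tau>) = (\<Sum>x\<in>A. a x * f (b x))"
  using assms(2,3)
proof (induction A rule: finite_induct)
  case empty
  then show ?case by (simp add: cochain_eval_zero[OF f])
next
  case (insert x A)
  then show ?case
    by (simp add: cochain_eval_add[OF f] cochain_eval_scale[OF f] chain_space_scale chain_space_sum)
qed

lemma cochain_space_zero: "(\<lambda>c. 0) \<in> cochain_space K n"
  by (simp add: cochain_space_def)

lemma cochain_space_add:
  "f \<in> cochain_space K n \<Longrightarrow> g \<in> cochain_space K n \<Longrightarrow> (\<lambda>c. f c + g c) \<in> cochain_space K n"
  by (simp add: cochain_space_def algebra_simps)

lemma cochain_space_scale: "f \<in> cochain_space K n \<Longrightarrow> (\<lambda>c. a * f c) \<in> cochain_space K n"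
  by (simp add: cochain_space_def algebra_simps)

lemma cochain_space_sum:
  assumes "finite A" "\<And>x. x \<in> A \<Longrightarrow> g x \<in> cochain_space K n"
  shows "(\<lambda>c. \<Sum>x\<in>A. a x * g x c) \<in> cochain_space K n"
  using assms
  by (induction A rule: finite_induct)
    (simp_all add: cochain_space_zero cochain_space_add cochain_space_scale)

lemma finite_enumerated_simplices: "enumerates_simplices K s \<Longrightarrow> finite (simplices K n)"
  by (metis List.finite_set enumerates_simplices_def)

lemma nth_enumerated_simplex:
  assumes "enumerates_simplices K s" "r < length (s n)"
  shows "s n ! r \<in> simplices K n"
  using assms(1) nth_mem[OF assms(2)] by (simp add: enumerates_simplices_def)

text \<open>Two cochains with the same values on simplices have the same expansion in elementary cochains.\<close>

lemma cochain_eqI: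
  fixes f g :: "('v, 'f::field) cochain"
  assumes s: "enumerates_simplices K s"
    and f: "f \<in> cochain_space K n" and g: "g \<in> cochain_space K n"
    and eq: "\<And>\<sigma>. \<sigma> \<in> simplices K n \<Longrightarrow> f (basis_chain \<sigma>) = g (basis_chain \<sigma>)"
  shows "f = g"
proof -
  have "(\<lambda>c. \<Sum>r<length (s n). f (basis_chain (s n ! r)) * elementary_cochain K n (s n ! r) c)
      = (\<lambda>c. \<Sum>r<length (s n). g (basis_chain (s n ! r)) * elementary_cochain K n (s n ! r) c)"
    by (simp add: eq nth_enumerated_simplex[OF s])
  then show ?thesis
    by (rule trans[OF cochain_expansion[OF s f] trans[OF _ cochain_expansion[OF s g, symmetric]]])
qed

text \<open>
  Linear maps from \<open>cochain_space K m\<close> to \<open>cochain_space K n\<close>.  Linearity is required only on that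
  domain, since an adjoint is unspecified outside it.
\<close>

definition cochain_map ::
  "'v set set \<Rightarrow> int \<Rightarrow> int \<Rightarrow> (('v, 'f::field) cochain \<Rightarrow> ('v, 'f) cochain) \<Rightarrow> bool" where
  "cochain_map K m n T \<longleftrightarrow>
     (\<forall>f\<in>cochain_space K m. T f \<in> cochain_space K n) \<and>
     (\<forall>f\<in>cochain_space K m. \<forall>g\<in>cochain_space K m. T (\<lambda>c. f c + g c) = (\<lambda>c. T f c + T g c)) \<and>
     (\<forall>a. \<forall>f\<in>cochain_space K m. T (\<lambda>c. a * f c) = (\<lambda>c. a * T f c))"

lemma cochain_map_in: "cochain_map K m n T \<Longrightarrow> f \<in> cochain_space K m \<Longrightarrow> T f \<in> cochain_space K n"
  by (simp add: cochain_map_def)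

lemma cochain_map_add:
  "cochain_map K m n T \<Longrightarrow> f \<in> cochain_space K m \<Longrightarrow> g \<in> cochain_space K m
    \<Longrightarrow> T (\<lambda>c. f c + g c) = (\<lambda>c. T f c + T g c)"
  by (simp add: cochain_map_def)

lemma cochain_map_scale:
  "cochain_map K m n T \<Longrightarrow> f \<in> cochain_space K m \<Longrightarrow> T (\<lambda>c. a * f c) = (\<lambda>c. a * T f c)"
  by (simp add: cochain_map_def)

lemma cochain_map_sum:
  assumes T: "cochain_map K m n T" and "finite A" "\<And>x. x \<in> A \<Longrightarrow> g x \<in> cochain_space K m"
  shows "T (\<lambda>c. \<Sum>x\<in>A. a x * g x c) = (\<lambda>c. \<Sum>x\<in>A. a x * T (g x) c)"
  using assms(2,3)
proof (induction A rule: finite_induct)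
  case empty
  have "T (\<lambda>c. 0 * 0) = (\<lambda>c. 0 * T (\<lambda>c. 0) c)"
    by (rule cochain_map_scale[OF T cochain_space_zero])
  then show ?case by simp
next
  case (insert x A)
  have "T (\<lambda>c. a x * g x c + (\<Sum>x\<in>A. a x * g x c))
      = (\<lambda>c. T (\<lambda>c. a x * g x c) c + T (\<lambda>c. \<Sum>x\<in>A. a x * g x c) c)"
    using insert by (intro cochain_map_add[OF T] cochain_space_scale cochain_space_sum) auto
  moreover have "T (\<lambda>c. a x * g x c) = (\<lambda>c. a x * T (g x) c)"
    using insert by (intro cochain_map_scale[OF T]) auto
  ultimately show ?case using insert by simp
qed

lemma cochain_map_expansion:
  assumes s: "enumerates_simplices K s" and T: "cochain_map K m n T" and f: "f \<in> cochain_space K m"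
  shows "T f c = (\<Sum>r<length (s m). f (basis_chain (s m ! r)) * T (elementary_cochain K m (s m ! r)) c)"
  by (subst cochain_expansion[OF s f])
    (simp add: cochain_map_sum[OF T] elementary_cochain_in_cochain_space)

lemma sum_simplices_enumerated:
  assumes "enumerates_simplices K s"
  shows "(\<Sum>\<sigma>\<in>simplices K n. h \<sigma>) = (\<Sum>r<length (s n). h (s n ! r))"
  using assms sum.reindex_bij_betw[OF bij_betw_nth[of "s n" "{..<length (s n)}" "simplices K n"], of h]
  by (simp add: enumerates_simplices_def)

section \<open>The coboundary operators\<close>

text \<open>
  The summation ranges over the support of the chain, which changes under addition.  Additivity
  follows because all the supports involved may be enlarged to one common finite set.
\<close>

lemma linear_extension_in_cochain_space:
  fixes F :: "'v set \<Rightarrow> 'f::field"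
  shows "(\<lambda>c. if c \<in> chain_space K n then \<Sum>\<sigma> | c \<sigma> \<noteq> 0. c \<sigma> * F \<sigma> else 0) \<in> cochain_space K n"
proof -
  have widen: "(\<Sum>\<sigma> | c \<sigma> \<noteq> 0. c \<sigma> * F \<sigma>) = (\<Sum>\<sigma>\<in>A. c \<sigma> * F \<sigma>)"
    if "finite A" "{\<sigma>. c \<sigma> \<noteq> 0} \<subseteq> A" for A and c :: "('v, 'f) chain"
    using that by (intro sum.mono_neutral_left) auto
  have add: "(\<Sum>\<sigma> | c \<sigma> + d \<sigma> \<noteq> 0. (c \<sigma> + d \<sigma>) * F \<sigma>)
      = (\<Sum>\<sigma> | c \<sigma> \<noteq> 0. c \<sigma> * F \<sigma>) + (\<Sum>\<sigma> | d \<sigma> \<noteq> 0. d \<sigma> * F \<sigma>)"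
    if "c \<in> chain_space K n" "d \<in> chain_space K n" for c d :: "('v, 'f) chain"
  proof -
    let ?A = "{\<sigma>. c \<sigma> \<noteq> 0} \<union> {\<sigma>. d \<sigma> \<noteq> 0}"
    have fin: "finite ?A" using that by (simp add: chain_space_def)
    have sub: "{\<sigma>. c \<sigma> + d \<sigma> \<noteq> 0} \<subseteq> ?A" by auto
    show ?thesis
      unfolding widen[OF fin sub] widen[OF fin Un_upper1] widen[OF fin Un_upper2]
      by (simp only: distrib_right sum.distrib)
  qed
  have scale: "(\<Sum>\<sigma> | a * c \<sigma> \<noteq> 0. a * c \<sigma> * F \<sigma>) = a * (\<Sum>\<sigma> | c \<sigma> \<noteq> 0. c \<sigma> * F \<sigma>)"
    for a and c :: "('v, 'f) chain"
    by (cases "a = 0") (simp_all add: sum_distrib_left mult.assoc)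
  show ?thesis
    unfolding cochain_space_def
    by (simp add: chain_space_add chain_space_scale add) (use scale in simp)
qed

lemma coboundary_cochain_map: "cochain_map K n (n + 1) (coboundary K n)"
  unfolding cochain_map_def
proof (intro conjI ballI allI)
  fix f :: "('a, 'b) cochain"
  show "coboundary K n f \<in> cochain_space K (n + 1)"
    unfolding coboundary_def by (rule linear_extension_in_cochain_space)
next
  fix f g :: "('a, 'b) cochain"
  show "coboundary K n (\<lambda>c. f c + g c) = (\<lambda>c. coboundary K n f c + coboundary K n g c)"
    by (auto simp: coboundary_def fun_eq_iff distrib_left sum.distrib)
next
  fix a and f :: "('a, 'b) cochain"
  show "coboundary K n (\<lambda>c. a * f c) = (\<lambda>c. a * coboundary K n f c)"
    by (auto simp: coboundary_def fun_eq_iff sum_distrib_left mult.left_commute)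
qed

lemma coboundary_basis_chain:
  fixes f :: "('v::linorder, 'f::field) cochain"
  assumes "\<tau> \<in> simplices K (n + 1)"
  shows "coboundary K n f (basis_chain \<tau>) = (\<Sum>i\<le>nat (n + 1). (-1) ^ i * f (basis_chain (face i \<tau>)))"
proof -
  have "{\<sigma>. basis_chain \<tau> \<sigma> \<noteq> (0::'f)} = {\<tau>}" by (auto simp: basis_chain_def)
  then show ?thesis
    using basis_chain_in_chain_space[OF assms, where 'b = 'f]
    by (simp add: coboundary_def) (simp add: basis_chain_def)
qed

text \<open>
  The entries are alternating sums of zeros and ones.  This is what turns the conjugate transpose
  in the matrix of the adjoint into the transpose.
\<close>

lemma coboundary_matrix_real:
  assumes s: "enumerates_simplices K s" and "r < length (s (n + 1))" "k < length (s n)"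
  shows "cochain_matrix K s n (n + 1) (coboundary K n) $$ (r, k) \<in> (\<real> :: 'f::real_field set)"
proof -
  have r: "s (n + 1) ! r \<in> simplices K (n + 1)"
    by (rule nth_enumerated_simplex[OF s assms(2)])
  have "elementary_cochain K n (s n ! k) (basis_chain \<sigma>) \<in> (\<real> :: 'f set)" for \<sigma>
    by (auto simp: elementary_cochain_def basis_chain_def)
  then have "(\<Sum>i\<le>nat (n + 1). (-1) ^ i *
      elementary_cochain K n (s n ! k) (basis_chain (face i (s (n + 1) ! r)))) \<in> (\<real> :: 'f set)"
    by (intro sum_in_Reals Reals_mult Reals_power Reals_minus Reals_1) auto
  then show ?thesis
    using assms(2,3) by (simp add: cochain_matrix_def coboundary_basis_chain[OF r])
qed

lemma face_in_simplices:
  assumes K: "simplicial_complex K" and \<sigma>: "\<sigma> \<in> simplices K (n + 1)"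
    and n: "0 \<le> n" and i: "i \<le> nat (n + 1)"
  shows "face i \<sigma> \<in> simplices K n"
proof -
  have fin: "finite \<sigma>" and \<sigma>K: "\<sigma> \<in> K" and card: "int (card \<sigma>) = n + 2"
    using K \<sigma> by (auto simp: simplices_def simplicial_complex_def)
  have "sorted_list_of_set \<sigma> ! i \<in> set (sorted_list_of_set \<sigma>)"
    using card i n fin by (intro nth_mem) auto
  then have v: "sorted_list_of_set \<sigma> ! i \<in> \<sigma>"
    using fin by simp
  have c: "int (card (face i \<sigma>)) = n + 1"
    using card n v fin by (simp add: face_def card_Diff_singleton)
  then have "face i \<sigma> \<noteq> {}" using n by auto
  moreover have "face i \<sigma> \<subseteq> \<sigma>" by (auto simp: face_def)
  ultimately have "face i \<sigma> \<in> K" using K \<sigma>K unfolding simplicial_complex_def by blast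
  with c show ?thesis by (simp add: simplices_def)
qed

text \<open>
  Simplices are nonempty, so there are none of negative dimension.  This disposes of the degrees in which
  the boundary is zero by definition, in particular of the coboundary from degree \<open>-1\<close> in the
  down-Laplacian of degree \<open>0\<close>.
\<close>

lemma negative_cochain_zero:
  fixes f :: "('v, 'f::field) cochain"
  assumes K: "simplicial_complex K" and f: "f \<in> cochain_space K n" and n: "n < 0"
  shows "f c = 0"
proof (cases "c \<in> chain_space K n")
  case True
  have "0 < card \<sigma>" if "\<sigma> \<in> K" for \<sigma>
    using K that by (auto simp: simplicial_complex_def card_gt_0_iff)
  then have "simplices K n = {}"
    using n by (force simp: simplices_def)
  then have "c = (\<lambda>\<sigma>. 0)" using True by (auto simp: chain_space_def)
  then show ?thesis using cochain_eval_zero[OF f] by simp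
qed (simp add: cochain_eval_outside[OF f])

text \<open>
  In degree \<open>n \<ge> 0\<close> all faces of an \<open>(n + 1)\<close>-simplex are \<open>n\<close>-simplices, so a cochain can be moved inside both
  sums of the boundary, where each weight is \<open>1\<close>.  In negative degree both sides vanish.
\<close>

lemma weighted_coboundary_identity_weight:
  fixes f :: "('v::linorder, 'f::field) cochain"
  assumes K: "simplicial_complex K" and \<phi>: "identity_weight K \<phi>" and f: "f \<in> cochain_space K n"
  shows "weighted_coboundary K \<phi> n f = coboundary K n f"
proof (cases "0 \<le> n")
  case False
  then show ?thesis
    using negative_cochain_zero[OF K f]
    by (auto simp: weighted_coboundary_def coboundary_def fun_eq_iff)
next
  case True
  have "f (boundary \<phi> (n + 1) c)
      = (\<Sum>\<sigma> | c \<sigma> \<noteq> 0. c \<sigma> * (\<Sum>i\<le>nat (n + 1). (-1) ^ i * f (basis_chain (face i \<sigma>))))"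
    if c: "c \<in> chain_space K (n + 1)" for c :: "('v, 'f) chain"
  proof -
    let ?B = "\<lambda>\<sigma> \<tau>. \<Sum>i\<le>nat (n + 1). (-1) ^ i * \<phi> \<sigma> (face i \<sigma>) * basis_chain (face i \<sigma>) \<tau>"
    have fin: "finite {\<sigma>. c \<sigma> \<noteq> 0}" and supp: "\<And>\<sigma>. c \<sigma> \<noteq> 0 \<Longrightarrow> \<sigma> \<in> simplices K (n + 1)"
      using c by (auto simp: chain_space_def)
    have bas: "basis_chain (face i \<sigma>) \<in> chain_space K n" if "c \<sigma> \<noteq> 0" "i \<le> nat (n + 1)" for i \<sigma>
      by (intro basis_chain_in_chain_space face_in_simplices[OF K supp[OF that(1)] True that(2)])
    have one: "\<phi> \<sigma> (face i \<sigma>) = 1" if "c \<sigma> \<noteq> 0" "i \<le> nat (n + 1)" for i \<sigma>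
      using \<phi> supp[OF that(1)] that(2) True by (auto simp: identity_weight_def simplices_def)
    have "f (boundary \<phi> (n + 1) c) = f (\<lambda>\<tau>. \<Sum>\<sigma> | c \<sigma> \<noteq> 0. c \<sigma> * ?B \<sigma> \<tau>)"
      using True by (simp add: boundary_def)
    also have "\<dots> = (\<Sum>\<sigma> | c \<sigma> \<noteq> 0. c \<sigma> * f (?B \<sigma>))"
      using fin bas by (intro cochain_eval_sum[OF f] chain_space_sum) auto
    also have "\<dots> = (\<Sum>\<sigma> | c \<sigma> \<noteq> 0. c \<sigma> * (\<Sum>i\<le>nat (n + 1). (-1) ^ i * f (basis_chain (face i \<sigma>))))"
    proof (intro sum.cong refl arg_cong2[where f = "(*)"])
      fix \<sigma> assume "\<sigma> \<in> {\<sigma>. c \<sigma> \<noteq> 0}"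
      then have \<sigma>: "c \<sigma> \<noteq> 0" by simp
      have "f (?B \<sigma>) = (\<Sum>i\<le>nat (n + 1). (-1) ^ i * \<phi> \<sigma> (face i \<sigma>) * f (basis_chain (face i \<sigma>)))"
        using bas[OF \<sigma>] by (intro cochain_eval_sum[OF f]) auto
      then show "f (?B \<sigma>) = (\<Sum>i\<le>nat (n + 1). (-1) ^ i * f (basis_chain (face i \<sigma>)))"
        using one[OF \<sigma>] by simp
    qed
    finally show ?thesis .
  qed
  then show ?thesis by (auto simp: weighted_coboundary_def coboundary_def fun_eq_iff)
qed

section \<open>Adjoints\<close>

lemma cochain_inner_elementary_left:
  fixes g :: "('v, 'f::{real_field, conjugatable_field}) cochain"
  assumes "finite (simplices K m)" "\<sigma> \<in> simplices K m"
  shows "cochain_inner K w m (elementary_cochain K m \<sigma>) g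
    = of_real (w \<sigma>) * conjugate (g (basis_chain \<sigma>))"
proof -
  have "cochain_inner K w m (elementary_cochain K m \<sigma>) g
      = (\<Sum>\<tau>\<in>simplices K m. if \<sigma> = \<tau> then of_real (w \<tau>) * conjugate (g (basis_chain \<tau>)) else 0)"
    unfolding cochain_inner_def by (intro sum.cong) (auto simp: elementary_cochain_basis_chain)
  then show ?thesis using assms by simp
qed

text \<open>
  The witness is the operator that the defining equation forces: testing it against \<open>f = \<sigma>\<^sup>*\<close>
  prescribes the value on \<open>\<sigma>\<close>.  The equation for a general \<open>f\<close> then follows by expanding \<open>f\<close> in
  elementary cochains and exchanging the two sums.
\<close>

lemma cochain_adjoint_exists:
  fixes T :: "('v, 'f::{real_field, conjugatable_field}) cochain \<Rightarrow> ('v, 'f) cochain"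
  assumes conj_real: "\<And>x. conjugate (of_real x :: 'f) = of_real x"
    and s: "enumerates_simplices K s" and w: "\<forall>\<sigma>\<in>K. 0 < w \<sigma>" and T: "cochain_map K m n T"
  shows "\<exists>S. (\<forall>g\<in>cochain_space K n. S g \<in> cochain_space K m) \<and>
    (\<forall>f\<in>cochain_space K m. \<forall>g\<in>cochain_space K n.
       cochain_inner K w n (T f) g = cochain_inner K w m f (S g))"
proof -
  have fin: "finite (simplices K k)" for k
    by (rule finite_enumerated_simplices[OF s])
  define e :: "'v set \<Rightarrow> ('v, 'f) cochain" where "e = elementary_cochain K m"
  have e: "e \<sigma> \<in> cochain_space K m" for \<sigma>
    by (simp add: e_def elementary_cochain_in_cochain_space)
  define S where "S g = (\<lambda>c. \<Sum>\<sigma>\<in>simplices K m.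
    conjugate (cochain_inner K w n (T (e \<sigma>)) g) / of_real (w \<sigma>) * e \<sigma> c)" for g
  have in_space: "S g \<in> cochain_space K m" for g
    unfolding S_def by (intro cochain_space_sum fin e)
  have S_val: "S g (basis_chain \<sigma>) = conjugate (cochain_inner K w n (T (e \<sigma>)) g) / of_real (w \<sigma>)"
    if "\<sigma> \<in> simplices K m" for g \<sigma>
  proof -
    have "S g (basis_chain \<sigma>) = (\<Sum>\<tau>\<in>simplices K m. if \<tau> = \<sigma> then
        conjugate (cochain_inner K w n (T (e \<tau>)) g) / of_real (w \<tau>) else 0)"
      unfolding S_def e_def by (intro sum.cong) (auto simp: elementary_cochain_basis_chain[OF that])
    then show ?thesis using that fin by simp
  qed
  have "cochain_inner K w n (T f) g = cochain_inner K w m f (S g)"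
    if f: "f \<in> cochain_space K m" for f g
  proof -
    have wS: "of_real (w \<sigma>) * conjugate (S g (basis_chain \<sigma>)) = cochain_inner K w n (T (e \<sigma>)) g"
      if \<sigma>: "\<sigma> \<in> simplices K m" for \<sigma>
    proof -
      have "w \<sigma> \<noteq> 0" using \<sigma> w by (force simp: simplices_def)
      moreover have "of_real (w \<sigma>) * conjugate (S g (basis_chain \<sigma>))
          = conjugate (of_real (w \<sigma>) * S g (basis_chain \<sigma>))"
        by (simp add: conjugate_dist_mul conj_real)
      ultimately show ?thesis by (simp add: S_val[OF \<sigma>])
    qed
    have Tf: "T f c = (\<Sum>\<sigma>\<in>simplices K m. f (basis_chain \<sigma>) * T (e \<sigma>) c)" for c
      unfolding sum_simplices_enumerated[OF s] e_def by (rule cochain_map_expansion[OF s T f])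
    have "cochain_inner K w n (T f) g
        = (\<Sum>\<tau>\<in>simplices K n. \<Sum>\<sigma>\<in>simplices K m. f (basis_chain \<sigma>) *
            (of_real (w \<tau>) * T (e \<sigma>) (basis_chain \<tau>) * conjugate (g (basis_chain \<tau>))))"
      unfolding cochain_inner_def Tf by (simp add: sum_distrib_left sum_distrib_right mult_ac)
    also have "\<dots> = (\<Sum>\<sigma>\<in>simplices K m. f (basis_chain \<sigma>) * cochain_inner K w n (T (e \<sigma>)) g)"
      by (subst sum.swap) (simp add: cochain_inner_def sum_distrib_left)
    also have "\<dots> = cochain_inner K w m f (S g)"
      unfolding cochain_inner_def[of K w m] by (intro sum.cong refl) (simp add: wS[symmetric] mult_ac)
    finally show ?thesis .
  qed
  with in_space show ?thesis by blast
qed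

lemma cochain_adjoint_spec:
  fixes T :: "('v, 'f::{real_field, conjugatable_field}) cochain \<Rightarrow> ('v, 'f) cochain"
  assumes "\<And>x. conjugate (of_real x :: 'f) = of_real x"
    and "enumerates_simplices K s" and "\<forall>\<sigma>\<in>K. 0 < w \<sigma>" and "cochain_map K m n T"
    and g: "g \<in> cochain_space K n"
  shows cochain_adjoint_in: "cochain_adjoint K w m n T g \<in> cochain_space K m"
    and cochain_inner_adjoint: "f \<in> cochain_space K m \<Longrightarrow>
      cochain_inner K w n (T f) g = cochain_inner K w m f (cochain_adjoint K w m n T g)"
  using someI_ex[OF cochain_adjoint_exists[OF assms(1-4)]] g
  unfolding cochain_adjoint_def by blast+

lemma cochain_adjoint_cong:
  assumes "\<And>f. f \<in> cochain_space K m \<Longrightarrow> T f = T' f"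
  shows "cochain_adjoint K w m n T = cochain_adjoint K w m n T'"
  using assms unfolding cochain_adjoint_def by (simp cong: ball_cong)

text \<open>
  Although the adjoint is introduced by choice, the defining equation with \<open>f = \<sigma>\<^sup>*\<close> determines its values.
  Linearity of the adjoint and its matrix are both read off from this formula.
\<close>

lemma cochain_adjoint_basis_chain:
  fixes T :: "('v, 'f::{real_field, conjugatable_field}) cochain \<Rightarrow> ('v, 'f) cochain"
  assumes conj_real: "\<And>x. conjugate (of_real x :: 'f) = of_real x"
    and s: "enumerates_simplices K s" and w: "\<forall>\<sigma>\<in>K. 0 < w \<sigma>" and T: "cochain_map K m n T"
    and g: "g \<in> cochain_space K n" and \<sigma>: "\<sigma> \<in> simplices K m"
  shows "cochain_adjoint K w m n T g (basis_chain \<sigma>) =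
    (\<Sum>\<tau>\<in>simplices K n. of_real (w \<tau>) *
       conjugate (T (elementary_cochain K m \<sigma>) (basis_chain \<tau>)) * g (basis_chain \<tau>)) / of_real (w \<sigma>)"
    (is "?S = ?R / _")
proof -
  have fin: "finite (simplices K k)" for k
    by (rule finite_enumerated_simplices[OF s])
  have "of_real (w \<sigma>) * ?S = conjugate (of_real (w \<sigma>) * conjugate ?S)"
    by (simp add: conjugate_dist_mul conj_real)
  also have "of_real (w \<sigma>) * conjugate ?S = cochain_inner K w n (T (elementary_cochain K m \<sigma>)) g"
    using cochain_inner_adjoint[OF conj_real s w T g elementary_cochain_in_cochain_space]
    by (simp add: cochain_inner_elementary_left[OF fin \<sigma>])
  also have "conjugate \<dots> = ?R"
    by (simp add: cochain_inner_def sum_conjugate[OF fin] conjugate_dist_mul conj_real)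
  finally have "of_real (w \<sigma>) * ?S = ?R" .
  moreover have "w \<sigma> \<noteq> 0" using \<sigma> w by (force simp: simplices_def)
  ultimately show ?thesis by (simp add: field_simps)
qed

lemma cochain_adjoint_cochain_map:
  fixes T :: "('v, 'f::{real_field, conjugatable_field}) cochain \<Rightarrow> ('v, 'f) cochain"
  assumes conj_real: "\<And>x. conjugate (of_real x :: 'f) = of_real x"
    and s: "enumerates_simplices K s" and w: "\<forall>\<sigma>\<in>K. 0 < w \<sigma>" and T: "cochain_map K m n T"
  shows "cochain_map K n m (cochain_adjoint K w m n T)"
proof -
  note val = cochain_adjoint_basis_chain[OF conj_real s w T]
  note adj_in = cochain_adjoint_in[OF conj_real s w T]
  show ?thesis
    unfolding cochain_map_def
  proof (intro conjI ballI allI)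
    fix f :: "('v, 'f) cochain" assume f: "f \<in> cochain_space K n"
    then show "cochain_adjoint K w m n T f \<in> cochain_space K m" by (rule adj_in)
    show "cochain_adjoint K w m n T (\<lambda>c. a * f c) = (\<lambda>c. a * cochain_adjoint K w m n T f c)" for a
      using f by (intro cochain_eqI[OF s adj_in cochain_space_scale[OF adj_in]] cochain_space_scale)
        (simp_all add: val cochain_space_scale sum_distrib_left mult_ac)
    fix g :: "('v, 'f) cochain" assume g: "g \<in> cochain_space K n"
    show "cochain_adjoint K w m n T (\<lambda>c. f c + g c)
        = (\<lambda>c. cochain_adjoint K w m n T f c + cochain_adjoint K w m n T g c)"
      using f g by (intro cochain_eqI[OF s adj_in cochain_space_add[OF adj_in adj_in]] cochain_space_add)
        (simp_all add: val cochain_space_add sum.distrib distrib_left add_divide_distrib)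
  qed
qed

section \<open>Matrices\<close>

lemma cochain_matrix_carrier [simp]:
  "cochain_matrix K s m n T \<in> carrier_mat (length (s n)) (length (s m))"
  by (simp add: cochain_matrix_def)

lemma weight_matrix_carrier [simp]: "weight_matrix w s n \<in> carrier_mat (length (s n)) (length (s n))"
  by (simp add: weight_matrix_def)

lemma cochain_matrix_cong:
  assumes "\<And>f. f \<in> cochain_space K m \<Longrightarrow> T f = T' f"
  shows "cochain_matrix K s m n T = cochain_matrix K s m n T'"
  by (simp add: cochain_matrix_def assms elementary_cochain_in_cochain_space)

lemma cochain_matrix_comp:
  assumes s: "enumerates_simplices K s"
    and A: "\<And>f. f \<in> cochain_space K m \<Longrightarrow> A f \<in> cochain_space K n"
    and B: "cochain_map K n p B"
  shows "cochain_matrix K s m p (B \<circ> A) = cochain_matrix K s n p B * cochain_matrix K s m n A"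
proof (rule eq_matI)
  fix r k assume "r < dim_row (cochain_matrix K s n p B * cochain_matrix K s m n A)"
    "k < dim_col (cochain_matrix K s n p B * cochain_matrix K s m n A)"
  then show "cochain_matrix K s m p (B \<circ> A) $$ (r, k)
      = (cochain_matrix K s n p B * cochain_matrix K s m n A) $$ (r, k)"
    by (simp add: cochain_matrix_def scalar_prod_def atLeast0LessThan mult.commute
        cochain_map_expansion[OF s B A[OF elementary_cochain_in_cochain_space]])
qed (simp_all add: cochain_matrix_def)

lemma inverse_mat_eqI:
  assumes A: "A \<in> carrier_mat n n" and B: "B \<in> carrier_mat n n"
    and AB: "A * B = 1\<^sub>m n" and BA: "B * A = 1\<^sub>m n"
  shows "inverse_mat A = B"
proof (cases "mat_inverse A")
  case None
  \<comment> \<open>The last argument fills the extension slot of the ring record; any value will do.\<close>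
  have "A \<in> Units (ring_mat TYPE('a) n ())"
    using A B AB BA by (auto simp: Units_def ring_mat_def)
  with mat_inverse(1)[OF A None, of "()"] show ?thesis by blast
next
  case (Some C)
  then have C: "C * A = 1\<^sub>m n" "C \<in> carrier_mat n n" using mat_inverse(2)[OF A] by auto
  have "C = C * (A * B)" using AB C by simp
  also have "\<dots> = (C * A) * B" using assoc_mult_mat[OF C(2) A B] by simp
  finally show ?thesis using Some B C by simp
qed

lemma weight_matrix_times:
  assumes "A \<in> carrier_mat (length (s n)) c" "r < length (s n)" "k < c"
  shows "(weight_matrix w s n * A) $$ (r, k) = of_real (w (s n ! r)) * A $$ (r, k)"
proof -
  have "(weight_matrix w s n * A) $$ (r, k)
      = (\<Sum>t\<in>{0..<length (s n)}. (if r = t then of_real (w (s n ! r)) else 0) * A $$ (t, k))"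
    using assms by (simp add: weight_matrix_def scalar_prod_def)
  also have "\<dots> = (\<Sum>t\<in>{0..<length (s n)}. if r = t then of_real (w (s n ! r)) * A $$ (t, k) else 0)"
    by (intro sum.cong) auto
  finally show ?thesis using assms by simp
qed

lemma times_weight_matrix:
  assumes "A \<in> carrier_mat b (length (s n))" "r < b" "k < length (s n)"
  shows "(A * weight_matrix w s n) $$ (r, k) = A $$ (r, k) * of_real (w (s n ! k))"
proof -
  have "(A * weight_matrix w s n) $$ (r, k)
      = (\<Sum>t\<in>{0..<length (s n)}. A $$ (r, t) * (if t = k then of_real (w (s n ! t)) else 0))"
    using assms by (simp add: weight_matrix_def scalar_prod_def)
  also have "\<dots> = (\<Sum>t\<in>{0..<length (s n)}. if t = k then A $$ (r, t) * of_real (w (s n ! t)) else 0)"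
    by (intro sum.cong) auto
  finally show ?thesis using assms by simp
qed

lemma inverse_weight_matrix:
  assumes "enumerates_simplices K s" and "\<forall>\<sigma>\<in>K. 0 < w \<sigma>"
  shows "inverse_mat (weight_matrix w s n :: 'f::real_field mat) = weight_matrix (\<lambda>\<sigma>. inverse (w \<sigma>)) s n"
proof -
  have nz: "w (s n ! r) \<noteq> 0" if "r < length (s n)" for r
    using assms nth_mem[OF that] by (force simp: enumerates_simplices_def simplices_def)
  have diag: "weight_matrix u s n * weight_matrix v s n = (1\<^sub>m (length (s n)) :: 'f mat)"
    if "\<And>r. r < length (s n) \<Longrightarrow> u (s n ! r) * v (s n ! r) = 1" for u v :: "'a set \<Rightarrow> real"
  proof (rule eq_matI)
    fix r k assume "r < dim_row (1\<^sub>m (length (s n)) :: 'f mat)" "k < dim_col (1\<^sub>m (length (s n)) :: 'f mat)"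
    then have rk: "r < length (s n)" "k < length (s n)" by simp_all
    have "(weight_matrix u s n * weight_matrix v s n) $$ (r, k)
        = of_real (u (s n ! r)) * (weight_matrix v s n :: 'f mat) $$ (r, k)"
      by (rule weight_matrix_times[where c = "length (s n)"]) (simp_all add: rk)
    also have "\<dots> = (1\<^sub>m (length (s n)) :: 'f mat) $$ (r, k)"
      using rk that[OF rk(1)] by (auto simp: weight_matrix_def simp flip: of_real_mult)
    finally show "(weight_matrix u s n * weight_matrix v s n) $$ (r, k)
        = (1\<^sub>m (length (s n)) :: 'f mat) $$ (r, k)" .
  qed (simp_all add: weight_matrix_def)
  show ?thesis
    by (rule inverse_mat_eqI) (auto intro!: diag simp: nz)
qed

lemma cochain_matrix_adjoint:
  fixes T :: "('v, 'f::{real_field, conjugatable_field}) cochain \<Rightarrow> ('v, 'f) cochain"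
  assumes conj_real: "\<And>x. conjugate (of_real x :: 'f) = of_real x"
    and s: "enumerates_simplices K s" and w: "\<forall>\<sigma>\<in>K. 0 < w \<sigma>" and T: "cochain_map K m n T"
  shows "cochain_matrix K s n m (cochain_adjoint K w m n T) =
    inverse_mat (weight_matrix w s m) * transpose_mat (map_mat conjugate (cochain_matrix K s m n T))
      * weight_matrix w s n" (is "?L = ?R")
proof -
  have mem: "s k ! r \<in> simplices K k" if "r < length (s k)" for k r
    by (rule nth_enumerated_simplex[OF s that])
  have fin: "finite (simplices K n)"
    by (rule finite_enumerated_simplices[OF s])
  have D: "transpose_mat (map_mat conjugate (cochain_matrix K s m n T))
      \<in> carrier_mat (length (s m)) (length (s n))"
    by simp
  show ?thesis
    unfolding inverse_weight_matrix[OF s w]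
  proof (rule eq_matI)
    let ?R = "weight_matrix (\<lambda>\<sigma>. inverse (w \<sigma>)) s m
      * transpose_mat (map_mat conjugate (cochain_matrix K s m n T)) * weight_matrix w s n"
    fix r k assume "r < dim_row ?R" "k < dim_col ?R"
    then have r: "r < length (s m)" and k: "k < length (s n)" by (simp_all add: weight_matrix_def)
    let ?e = "conjugate (T (elementary_cochain K m (s m ! r)) (basis_chain (s n ! k)))"
    have "(\<Sum>\<tau>\<in>simplices K n. of_real (w \<tau>) *
          conjugate (T (elementary_cochain K m (s m ! r)) (basis_chain \<tau>)) *
          elementary_cochain K n (s n ! k) (basis_chain \<tau>))
        = (\<Sum>\<tau>\<in>simplices K n. if s n ! k = \<tau> then of_real (w \<tau>) *
          conjugate (T (elementary_cochain K m (s m ! r)) (basis_chain \<tau>)) else 0)"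
      by (intro sum.cong) (auto simp: elementary_cochain_basis_chain)
    also have "\<dots> = of_real (w (s n ! k)) * ?e"
      using mem[OF k] fin by simp
    finally have "?L $$ (r, k) = of_real (w (s n ! k)) * ?e / of_real (w (s m ! r))"
      using r k by (simp add: cochain_matrix_def cochain_adjoint_basis_chain[OF conj_real s w T
            elementary_cochain_in_cochain_space mem[OF r]])
    moreover have "?R $$ (r, k)
        = of_real (inverse (w (s m ! r))) * ?e * of_real (w (s n ! k))"
    proof -
      have "?R $$ (r, k) = (weight_matrix (\<lambda>\<sigma>. inverse (w \<sigma>)) s m
          * transpose_mat (map_mat conjugate (cochain_matrix K s m n T))) $$ (r, k) * of_real (w (s n ! k))"
        by (rule times_weight_matrix[where s = s and n = n, OF mult_carrier_mat[OF weight_matrix_carrier[where s = s and n = m] D] r k])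
      then show ?thesis
        using weight_matrix_times[where s = s and n = m, OF D r k, of "\<lambda>\<sigma>. inverse (w \<sigma>)"] r k
        by (simp add: cochain_matrix_def)
    qed
    ultimately show "?L $$ (r, k) = ?R $$ (r, k)"
      by (simp add: divide_inverse of_real_inverse mult_ac)
  qed (simp_all add: weight_matrix_def cochain_matrix_def)
qed

section \<open>Laplacians\<close>

lemma coboundary_adjoint_matrix:
  fixes K :: "'v::linorder set set"
  assumes conj_real: "\<And>x. conjugate (of_real x :: 'f::{real_field, conjugatable_field}) = of_real x"
    and s: "enumerates_simplices K s" and w: "\<forall>\<sigma>\<in>K. 0 < w \<sigma>"
  shows "cochain_matrix K s (n + 1) n (cochain_adjoint K w n (n + 1) (coboundary K n)) =
    inverse_mat (weight_matrix w s n)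
      * transpose_mat (cochain_matrix K s n (n + 1) (coboundary K n) :: 'f mat)
      * weight_matrix w s (n + 1)"
proof -
  have "map_mat conjugate (cochain_matrix K s n (n + 1) (coboundary K n) :: 'f mat)
      = cochain_matrix K s n (n + 1) (coboundary K n)"
  proof (rule eq_matI)
    fix r k assume "r < dim_row (cochain_matrix K s n (n + 1) (coboundary K n) :: 'f mat)"
      "k < dim_col (cochain_matrix K s n (n + 1) (coboundary K n) :: 'f mat)"
    then have rk: "r < length (s (n + 1))" "k < length (s n)" by (simp_all add: cochain_matrix_def)
    obtain x where "(cochain_matrix K s n (n + 1) (coboundary K n) :: 'f mat) $$ (r, k) = of_real x"
      using coboundary_matrix_real[OF s rk, where 'f = 'f] by (auto elim: Reals_cases)
    then show "map_mat conjugate (cochain_matrix K s n (n + 1) (coboundary K n)) $$ (r, k)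
        = (cochain_matrix K s n (n + 1) (coboundary K n) :: 'f mat) $$ (r, k)"
      using rk by (simp add: conj_real cochain_matrix_def)
  qed simp_all
  then show ?thesis
    by (simp add: cochain_matrix_adjoint[OF conj_real s w coboundary_cochain_map])
qed

lemma laplacian_matrices:
  fixes K :: "'v::linorder set set" and \<phi> :: "'v set \<Rightarrow> 'v set \<Rightarrow> 'f::{real_field, conjugatable_field}"
  assumes conj_real: "\<And>x. conjugate (of_real x :: 'f) = of_real x"
    and K: "simplicial_complex K" and w: "\<forall>\<sigma>\<in>K. 0 < w \<sigma>"
    and \<phi>: "identity_weight K \<phi>" and s: "enumerates_simplices K s"
  defines "D \<equiv> \<lambda>j. cochain_matrix K s j (j + 1) (coboundary K j) :: 'f mat"
    and "W \<equiv> \<lambda>j. weight_matrix w s j :: 'f mat"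
  shows "cochain_matrix K s i i (weighted_up_laplacian K w \<phi> i)
      = cochain_matrix K s i i (up_laplacian K w i)"
    and "cochain_matrix K s i i (up_laplacian K w i)
      = inverse_mat (W i) * transpose_mat (D i) * W (i + 1) * D i"
    and "cochain_matrix K s i i (weighted_down_laplacian K w \<phi> i)
      = cochain_matrix K s i i (down_laplacian K w i)"
    and "cochain_matrix K s i i (down_laplacian K w i)
      = D (i - 1) * inverse_mat (W (i - 1)) * transpose_mat (D (i - 1)) * W i"
proof -
  note \<delta> = coboundary_cochain_map[of K, where 'b = 'f]
  note adj_in = cochain_adjoint_in[OF conj_real s w \<delta>]
  note adj_map = cochain_adjoint_cochain_map[OF conj_real s w \<delta>]
  have same: "weighted_coboundary K \<phi> j f = coboundary K j f" if "f \<in> cochain_space K j" for j f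
    using weighted_coboundary_identity_weight[OF K \<phi> that] .
  have same_adj: "cochain_adjoint K w j k (weighted_coboundary K \<phi> j)
      = cochain_adjoint K w j k (coboundary K j)" for j k
    by (rule cochain_adjoint_cong) (rule same)
  show "cochain_matrix K s i i (weighted_up_laplacian K w \<phi> i)
      = cochain_matrix K s i i (up_laplacian K w i)"
    by (rule cochain_matrix_cong) (simp add: weighted_up_laplacian_def up_laplacian_def same same_adj)
  show "cochain_matrix K s i i (up_laplacian K w i)
      = inverse_mat (W i) * transpose_mat (D i) * W (i + 1) * D i"
    unfolding up_laplacian_def D_def W_def
    by (simp only: cochain_matrix_comp[OF s cochain_map_in[OF \<delta>] adj_map]
        coboundary_adjoint_matrix[OF conj_real s w])
  \<comment> \<open>The adjoint takes values in \<open>cochain_space K (i - 1)\<close>, where the two coboundaries agree.\<close>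
  show "cochain_matrix K s i i (weighted_down_laplacian K w \<phi> i)
      = cochain_matrix K s i i (down_laplacian K w i)"
    using adj_in[of _ "i - 1"]
    by (intro cochain_matrix_cong)
      (simp add: weighted_down_laplacian_def down_laplacian_def same same_adj)
  have inv: "inverse_mat (W (i - 1)) \<in> carrier_mat (length (s (i - 1))) (length (s (i - 1)))"
    unfolding W_def inverse_weight_matrix[OF s w] by simp
  have Di: "D (i - 1) \<in> carrier_mat (length (s i)) (length (s (i - 1)))"
    using cochain_matrix_carrier[of K s "i - 1" i] by (simp add: D_def)
  then have Dt: "transpose_mat (D (i - 1)) \<in> carrier_mat (length (s (i - 1))) (length (s i))"
    by simp
  have Wi: "W i \<in> carrier_mat (length (s i)) (length (s i))"
    by (simp add: W_def)
  have "cochain_matrix K s i i (down_laplacian K w i)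
      = D (i - 1) * (inverse_mat (W (i - 1)) * transpose_mat (D (i - 1)) * W i)"
    using cochain_matrix_comp[OF s cochain_map_in[OF adj_map[of "i - 1"]] \<delta>[of "i - 1"]]
      coboundary_adjoint_matrix[OF conj_real s w, of "i - 1"]
    by (simp add: down_laplacian_def D_def W_def)
  also have "\<dots> = D (i - 1) * inverse_mat (W (i - 1)) * transpose_mat (D (i - 1)) * W i"
    unfolding assoc_mult_mat[OF Di inv Dt] assoc_mult_mat[OF Di mult_carrier_mat[OF inv Dt] Wi] ..
  finally show "cochain_matrix K s i i (down_laplacian K w i)
      = D (i - 1) * inverse_mat (W (i - 1)) * transpose_mat (D (i - 1)) * W i" .
qed

theorem proposition5p16:
  fixes K :: "'v::linorder set set"
    and w :: "'v set \<Rightarrow> real"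
    and \<phi> :: "'v set \<Rightarrow> 'v set \<Rightarrow> real"
    and \<psi> :: "'v set \<Rightarrow> 'v set \<Rightarrow> complex"
    and s :: "int \<Rightarrow> 'v set list"
    and i :: int
  assumes "simplicial_complex K"
    and "\<forall>n. finite (simplices K n)"
    and "\<forall>\<sigma>\<in>K. 0 < w \<sigma>"
    and "identity_weight K \<phi>"
    and "identity_weight K \<psi>"
    and "enumerates_simplices K s"
    and "0 \<le> i"
  shows
    "(let D = (\<lambda>j. cochain_matrix K s j (j + 1) (coboundary K j) :: real mat);
          W = (\<lambda>j. weight_matrix w s j :: real mat)
      in cochain_matrix K s i i (weighted_up_laplacian K w \<phi> i) =
           cochain_matrix K s i i (up_laplacian K w i) \<and>
         cochain_matrix K s i i (up_laplacian K w i) =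
           inverse_mat (W i) * transpose_mat (D i) * W (i + 1) * D i \<and>
         cochain_matrix K s i i (weighted_down_laplacian K w \<phi> i) =
           cochain_matrix K s i i (down_laplacian K w i) \<and>
         cochain_matrix K s i i (down_laplacian K w i) =
           D (i - 1) * inverse_mat (W (i - 1)) * transpose_mat (D (i - 1)) * W i) \<and>
     (let D = (\<lambda>j. cochain_matrix K s j (j + 1) (coboundary K j) :: complex mat);
          W = (\<lambda>j. weight_matrix w s j :: complex mat)
      in cochain_matrix K s i i (weighted_up_laplacian K w \<psi> i) =
           cochain_matrix K s i i (up_laplacian K w i) \<and>
         cochain_matrix K s i i (up_laplacian K w i) =
           inverse_mat (W i) * transpose_mat (D i) * W (i + 1) * D i \<and>
         cochain_matrix K s i i (weighted_down_laplacian K w \<psi> i) =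
           cochain_matrix K s i i (down_laplacian K w i) \<and>
         cochain_matrix K s i i (down_laplacian K w i) =
           D (i - 1) * inverse_mat (W (i - 1)) * transpose_mat (D (i - 1)) * W i)"
  using laplacian_matrices[of K w \<phi> s i] laplacian_matrices[of K w \<psi> s i] assms
  by (simp add: Let_def)

end
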